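(* Consider the facility location setting with clients $1,\dots,N$, facilities $E$ with $|E|=n$, scores $c(i,j)\ge0$, client functions $f_i(A)=\max_{j\in A}c(i,j)$ (with $f_i(\emptyset)=0$), $F=\sum_{i=1}^Nf_i$, and $\texttt{OPT}=\max_{S\subseteq E,|S|\le k}F(S)$. Suppose each client has importance factor $w_i=\max_{j\in E}\frac{c(i,j)}{F(\{j\})}$, and let $\varepsilon\in(0,1)$. Then Algorithm Federated Discrete Greedy, run on the uniform matroid of rank $k$ with an appropriate $\kappa=\tilde O(kn/\varepsilon^2)$, after $k$ communication rounds returns a set $S$ of size $k$ such that with probability at least $1-1/n$, $(1-1/\mathrm{e}-\varepsilon)\texttt{OPT}\le F(S)$. Moreover, the expected number of clients participating during each round is $\tilde O(kn^2/\varepsilon^2)$.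
   Context: Algorithm Federated Discrete Greedy (matroid $\mathcal{M}=(E,\mathcal{I})$ of rank $r$, here the uniform matroid $\{S:|S|\le k\}$ with $r=k$): set $S=\emptyset$. For $t=0,\dots,r-1$: the server sends $S$ to all clients; each client $i$ sets $\kappa_i=\min\{\kappa w_i,1\}$, computes $\Delta_i[e]=(f_i(S\cup\{e\})-f_i(S))/\kappa_i$ for all $e$ with $S\cup\{e\}\in\mathcal{I}$, and independently with probability $\kappa_i$ sends $\Delta_i$ to a secure aggregator (otherwise nothing); the aggregator computes the sum $\Delta^{(t)}$ of received vectors; the server adds $\arg\max_{e:S\cup\{e\}\in\mathcal{I}}\Delta^{(t)}[e]$ to $S$. Output $S$. *)

theory Defs
  imports "HOL-Probability.Probability"
begin

text \<open>Soft-O for functions of several parameters: a bound valid uniformly on the parameter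
  domain \<open>D\<close>, up to a polylogarithmic factor in the bounding function itself.
  The shift by 2 only keeps the logarithm bounded away from zero.\<close>

definition soft_bigo :: "'p set \<Rightarrow> ('p \<Rightarrow> real) \<Rightarrow> ('p \<Rightarrow> real) set" where
  "soft_bigo D g = {h. \<exists>C (p::nat). \<forall>x\<in>D. \<bar>h x\<bar> \<le> C * (g x * ln (2 + g x) ^ p)}"

definition uniform_matroid :: "'e set \<Rightarrow> nat \<Rightarrow> 'e set set" where
  "uniform_matroid E k = {S. S \<subseteq> E \<and> card S \<le> k}"

text \<open>Elements that can be added to \<open>S\<close>. Those already in \<open>S\<close> are excluded, so that every
  round of greedy enlarges the current set.\<close>

definition candidates :: "'e set \<Rightarrow> 'e set set \<Rightarrow> 'e set \<Rightarrow> 'e set" where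
  "candidates E \<I> S = {e \<in> E - S. S \<union> {e} \<in> \<I>}"

text \<open>A rule resolving the arg max of a vector \<open>v\<close> over the candidates; ties may be broken
  arbitrarily, depending on the round \<open>t\<close>, on \<open>S\<close> and on \<open>v\<close>.\<close>

definition argmax_rule ::
    "'e set \<Rightarrow> 'e set set \<Rightarrow> (nat \<Rightarrow> 'e set \<Rightarrow> ('e \<Rightarrow> real) \<Rightarrow> 'e) \<Rightarrow> bool" where
  "argmax_rule E \<I> sel \<longleftrightarrow>
     (\<forall>t S v. candidates E \<I> S \<noteq> {} \<longrightarrow>
        is_arg_max v (\<lambda>e. e \<in> candidates E \<I> S) (sel t S v))"

definition client_prob :: "(nat \<Rightarrow> real) \<Rightarrow> real \<Rightarrow> nat \<Rightarrow> real" where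
  "client_prob w \<kappa> i = min (\<kappa> * w i) 1"

definition sample_clients :: "nat \<Rightarrow> (nat \<Rightarrow> real) \<Rightarrow> nat set pmf" where
  "sample_clients N q =
     map_pmf (\<lambda>b. {i \<in> {1..N}. b i}) (Pi_pmf {1..N} False (\<lambda>i. bernoulli_pmf (q i)))"

definition aggregate ::
    "(nat \<Rightarrow> 'e set \<Rightarrow> real) \<Rightarrow> (nat \<Rightarrow> real) \<Rightarrow> 'e set \<Rightarrow> nat set \<Rightarrow> 'e \<Rightarrow> real" where
  "aggregate f q S P e = (\<Sum>i\<in>P. (f i (S \<union> {e}) - f i S) / q i)"

text \<open>Joint distribution, after the given number of rounds of Federated Discrete Greedy, of the
  current set and of the list of the sets of clients that participated in rounds 0, 1, 2, ....\<close>

primrec fed_greedy ::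
    "nat \<Rightarrow> (nat \<Rightarrow> 'e set \<Rightarrow> real) \<Rightarrow> (nat \<Rightarrow> real) \<Rightarrow> real \<Rightarrow>
     (nat \<Rightarrow> 'e set \<Rightarrow> ('e \<Rightarrow> real) \<Rightarrow> 'e) \<Rightarrow> nat \<Rightarrow> ('e set \<times> nat set list) pmf" where
  "fed_greedy N f w \<kappa> sel 0 = return_pmf ({}, [])"
| "fed_greedy N f w \<kappa> sel (Suc t) =
     bind_pmf (fed_greedy N f w \<kappa> sel t) (\<lambda>(S, Ps).
       map_pmf (\<lambda>P. (S \<union> {sel t S (aggregate f (client_prob w \<kappa>) S P)}, Ps @ [P]))
         (sample_clients N (client_prob w \<kappa>)))"

definition fl_client :: "(nat \<Rightarrow> 'e \<Rightarrow> real) \<Rightarrow> nat \<Rightarrow> 'e set \<Rightarrow> real" where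
  "fl_client c i A = (if A = {} then 0 else Max (c i ` A))"

definition fl_total :: "nat \<Rightarrow> (nat \<Rightarrow> 'e \<Rightarrow> real) \<Rightarrow> 'e set \<Rightarrow> real" where
  "fl_total N c A = (\<Sum>i=1..N. fl_client c i A)"

definition fl_opt :: "nat \<Rightarrow> 'e set \<Rightarrow> (nat \<Rightarrow> 'e \<Rightarrow> real) \<Rightarrow> nat \<Rightarrow> real" where
  "fl_opt N E c k = Max (fl_total N c ` {S. S \<subseteq> E \<and> card S \<le> k})"

text \<open>If \<open>fl_total N c {j} = 0\<close> then \<open>c i j = 0\<close> for every client \<open>i\<close>, and the quotient is 0.\<close>

definition fl_importance :: "nat \<Rightarrow> 'e set \<Rightarrow> (nat \<Rightarrow> 'e \<Rightarrow> real) \<Rightarrow> nat \<Rightarrow> real" where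
  "fl_importance N E c i = Max ((\<lambda>j. c i j / fl_total N c {j}) ` E)"

definition fl_params :: "(nat \<times> nat \<times> real) set" where
  "fl_params = {(k, n, \<epsilon>). 1 \<le> k \<and> k \<le> n \<and> 0 < \<epsilon> \<and> \<epsilon> < 1}"

end

theory Submission
  imports Defs
begin

text \<open>
  The sampled vector is an unbiased estimate of the true marginal gains. A client that is sampled
  with probability \<open>q\<^sub>i = \<kappa> w\<^sub>i < 1\<close> contributes at most \<open>c(i,e) / (\<kappa> w\<^sub>i) \<le> F({e}) / \<kappa> \<le> OPT / \<kappa>\<close>,
  so the estimate of each gain has variance at most \<open>OPT\<^sup>2 / \<kappa>\<close>, and a Chernoff bound gives additive
  error \<open>\<epsilon> OPT / (2k)\<close> except with probability \<open>2 exp (- \<kappa> \<epsilon>\<^sup>2 / (16 k\<^sup>2))\<close>. As \<open>k \<le> n\<close>, the choice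
  \<open>\<kappa> = 16 k n ln (2n\<^sup>3) / \<epsilon>\<^sup>2\<close> makes this at most \<open>1 / n\<^sup>3\<close>, which leaves room for a union bound over
  the rounds and the facilities. Outside the failure event every round is a greedy step for \<open>F\<close> with
  additive error \<open>\<epsilon> OPT / k\<close>, and these errors sum to \<open>\<epsilon> OPT\<close> on top of the usual \<open>1 - 1/e\<close> analysis.
  The expected number of participants is at most \<open>\<kappa> (\<Sum>i. w\<^sub>i) \<le> \<kappa> (\<Sum>i j. c(i,j) / F({j})) \<le> \<kappa> n\<close>.
\<close>

section \<open>Exponential moments and a tail bound for weighted Bernoulli sums\<close>

lemma exp_le_one_plus_plus_square:
  fixes x :: real
  assumes "\<bar>x\<bar> \<le> 1"
  shows "exp x \<le> 1 + x + x\<^sup>2"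
proof (cases "0 \<le> x")
  case True
  then show ?thesis using assms by (intro exp_bound) auto
next
  case False
  define y where "y = - x"
  have y: "0 < y" using False by (simp add: y_def)
  have "exp x = inverse (exp y)" by (simp add: y_def exp_minus)
  also have "\<dots> \<le> inverse (1 + y)"
    using y by (intro le_imp_inverse_le) auto
  also have "\<dots> \<le> 1 - y + y\<^sup>2"
  proof -
    \<comment> \<open>The product telescopes to \<open>1 + y ^ 3\<close>.\<close>
    have "1 \<le> (1 - y + y\<^sup>2) * (1 + y)"
      using y by (simp add: algebra_simps power2_eq_square)
    then show ?thesis using y by (simp add: field_simps)
  qed
  finally show ?thesis by (simp add: y_def)
qed

text \<open>The quadratic bound on \<open>exp\<close> followed by \<open>1 + u \<le> exp u\<close>
  leaves the linear term \<open>q * x\<close>, which the centering cancels. Keeping the factor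
  \<open>q\<close> in the exponent is essential: it later yields a variance instead of a squared
  range.\<close>

lemma bernoulli_centered_mgf_le:
  fixes q x :: real
  assumes "0 \<le> q" "q \<le> 1" "\<bar>x\<bar> \<le> 1"
  shows "measure_pmf.expectation (bernoulli_pmf q) (\<lambda>b. exp ((of_bool b - q) * x)) \<le> exp (q * x\<^sup>2)"
proof -
  have "measure_pmf.expectation (bernoulli_pmf q) (\<lambda>b. exp ((of_bool b - q) * x))
      = (1 + q * (exp x - 1)) * exp (- (q * x))"
    using assms by (simp add: algebra_simps exp_diff exp_minus field_simps)
  also have "\<dots> \<le> (1 + q * (x + x\<^sup>2)) * exp (- (q * x))"
    using exp_le_one_plus_plus_square[OF assms(3)] assms(1)
    by (intro mult_right_mono add_left_mono mult_left_mono) auto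
  also have "\<dots> \<le> exp (q * (x + x\<^sup>2)) * exp (- (q * x))"
    by (intro mult_right_mono) auto
  also have "\<dots> = exp (q * x\<^sup>2)"
    by (simp flip: exp_add add: algebra_simps)
  finally show ?thesis .
qed

text \<open>Finite support settles all integrability conditions for the client samples.\<close>

lemma finite_set_Pi_pmf_bernoulli:
  "finite A \<Longrightarrow> finite (set_pmf (Pi_pmf A False (\<lambda>i. bernoulli_pmf (q i))))"
  by (subst set_Pi_pmf) (auto intro!: finite_PiE_dflt)

text \<open>Chernoff's method in the Gaussian range of Bernstein's inequality:
  \<open>R * d \<le> 2 * V\<close> says that the optimal tilt keeps every tilted weight in [-1,1],
  where the moment bound applies.\<close>

lemma bernoulli_sum_upper_tail:
  fixes q a :: "'i \<Rightarrow> real"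
  assumes A: "finite A" and q: "\<And>i. i \<in> A \<Longrightarrow> 0 \<le> q i \<and> q i \<le> 1"
    and a: "\<And>i. i \<in> A \<Longrightarrow> q i < 1 \<Longrightarrow> \<bar>a i\<bar> \<le> R"
    and V: "(\<Sum>i | i \<in> A \<and> q i < 1. q i * (a i)\<^sup>2) \<le> V" "0 < V"
    and d: "0 \<le> d" "R * d \<le> 2 * V"
  shows "measure_pmf.prob (Pi_pmf A False (\<lambda>i. bernoulli_pmf (q i)))
           {b. d \<le> (\<Sum>i\<in>A. (of_bool (b i) - q i) * a i)} \<le> exp (- (d\<^sup>2 / (4 * V)))"
proof -
  \<comment> \<open>The minimizer of \<open>l\<^sup>2 * V - l * d\<close>; the minimum is
    \<open>- (d\<^sup>2 / (4 * V))\<close>.\<close>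
  define l where "l = d / (2 * V)"
  have l: "0 \<le> l" "l * R \<le> 1" using d V by (auto simp: l_def field_simps)
  let ?M = "Pi_pmf A False (\<lambda>i. bernoulli_pmf (q i))"
  let ?X = "\<lambda>b. \<Sum>i\<in>A. (of_bool (b i) - q i) * a i"
  \<comment> \<open>A coordinate with \<open>q i = 1\<close> is deterministic, so its centered term
    is 0 and its factor is 1, however large \<open>a i\<close> is.\<close>
  let ?W = "\<lambda>i. if q i < 1 then q i * (a i)\<^sup>2 else 0"
  have int: "integrable (measure_pmf ?M) f" for f :: "_ \<Rightarrow> real"
    by (intro integrable_measure_pmf_finite finite_set_Pi_pmf_bernoulli A)
  have factor: "measure_pmf.expectation (bernoulli_pmf (q i)) (\<lambda>b. exp ((of_bool b - q i) * (l * a i)))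
      \<le> exp (l\<^sup>2 * ?W i)" if i: "i \<in> A" for i
  proof (cases "q i < 1")
    case True
    have "\<bar>l * a i\<bar> \<le> l * R"
      using a[OF i True] l by (simp add: abs_mult mult_left_mono)
    then have "\<bar>l * a i\<bar> \<le> 1" using l by simp
    then have "measure_pmf.expectation (bernoulli_pmf (q i)) (\<lambda>b. exp ((of_bool b - q i) * (l * a i)))
        \<le> exp (q i * (l * a i)\<^sup>2)"
      using q[OF i] by (intro bernoulli_centered_mgf_le) auto
    then show ?thesis using True by (simp add: power_mult_distrib mult_ac)
  next
    case False
    then have "q i = 1" using q[OF i] by simp
    then show ?thesis by simp
  qed
  have "measure_pmf.expectation ?M (\<lambda>b. exp (l * ?X b))
      = measure_pmf.expectation ?M (\<lambda>b. \<Prod>i\<in>A. exp ((of_bool (b i) - q i) * (l * a i)))"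
    by (simp add: exp_sum[OF A, symmetric] sum_distrib_left mult_ac)
  also have "\<dots> = (\<Prod>i\<in>A. measure_pmf.expectation (bernoulli_pmf (q i)) (\<lambda>b. exp ((of_bool b - q i) * (l * a i))))"
    by (rule expectation_prod_Pi_pmf[OF A]) (auto intro: integrable_measure_pmf_finite)
  also have "\<dots> \<le> (\<Prod>i\<in>A. exp (l\<^sup>2 * ?W i))"
    by (intro prod_mono conjI factor Bochner_Integration.integral_nonneg) auto
  also have "\<dots> = exp (l\<^sup>2 * (\<Sum>i\<in>A. ?W i))"
    by (simp only: exp_sum[OF A, symmetric] sum_distrib_left)
  also have "(\<Sum>i\<in>A. ?W i) = (\<Sum>i | i \<in> A \<and> q i < 1. q i * (a i)\<^sup>2)"
    by (rule sum.inter_filter[OF A, symmetric])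
  also have "exp (l\<^sup>2 * \<dots>) \<le> exp (l\<^sup>2 * V)"
    using V by (simp add: mult_left_mono)
  finally have mgf: "measure_pmf.expectation ?M (\<lambda>b. exp (l * ?X b)) \<le> exp (l\<^sup>2 * V)" .
  have "measure_pmf.prob ?M {b. d \<le> ?X b} \<le> measure_pmf.prob ?M {b. exp (l * d) \<le> exp (l * ?X b)}"
    by (intro measure_pmf.finite_measure_mono) (auto intro: mult_left_mono l)
  also have "\<dots> \<le> measure_pmf.expectation ?M (\<lambda>b. exp (l * ?X b)) / exp (l * d)"
    using integral_Markov_inequality_measure[where M = "measure_pmf ?M" and A = "{}"
        and u = "\<lambda>b. exp (l * ?X b)" and c = "exp (l * d)"] int
    by simp
  also have "\<dots> \<le> exp (l\<^sup>2 * V) / exp (l * d)"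
    by (intro divide_right_mono mgf) auto
  also have "\<dots> = exp (- (d\<^sup>2 / (4 * V)))"
    using V by (simp add: l_def power2_eq_square field_simps flip: exp_diff)
  finally show ?thesis .
qed

text \<open>Union bound for one more round: \<open>A\<close> is failure so far, \<open>B\<close>
  failure afterwards, and \<open>p\<close> bounds the chance of failing now from a state that is
  still good. Inside \<open>A\<close> the trivial bound 1 is used.\<close>

lemma measure_bind_pmf_le:
  assumes "\<And>x. x \<in> set_pmf M \<Longrightarrow> x \<notin> A \<Longrightarrow> measure_pmf.prob (K x) B \<le> p" "0 \<le> p"
  shows "measure_pmf.prob (bind_pmf M K) B \<le> measure_pmf.prob M A + p"
proof -
  have "emeasure (bind_pmf M K) B = (\<integral>\<^sup>+x. emeasure (K x) B \<partial>M)" by simp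
  also have "\<dots> \<le> (\<integral>\<^sup>+x. indicator A x + ennreal p \<partial>M)"
  proof (intro nn_integral_mono_AE, rule AE_pmfI)
    fix x assume x: "x \<in> set_pmf M"
    show "emeasure (K x) B \<le> indicator A x + ennreal p"
    proof (cases "x \<in> A")
      case True
      have "emeasure (K x) B \<le> 1" by (rule measure_pmf.emeasure_le_1)
      also have "\<dots> \<le> 1 + ennreal p" by simp
      finally show ?thesis using True by simp
    next
      case False
      then show ?thesis using assms(1)[OF x False] assms(2)
        by (simp add: measure_pmf.emeasure_eq_measure)
    qed
  qed
  also have "\<dots> = emeasure M A + ennreal p"
    by (subst nn_integral_add) auto
  finally show ?thesis using assms(2)
    by (simp add: measure_pmf.emeasure_eq_measure flip: ennreal_plus)
qed

lemma expectation_card_sample_clients: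
  assumes "\<And>i. i \<in> {1..N} \<Longrightarrow> 0 \<le> q i \<and> q i \<le> 1"
  shows "measure_pmf.expectation (sample_clients N q) (\<lambda>P. real (card P)) = (\<Sum>i=1..N. q i)"
proof -
  let ?M = "Pi_pmf {1..N} False (\<lambda>i. bernoulli_pmf (q i))"
  have int: "integrable (measure_pmf ?M) f" for f :: "_ \<Rightarrow> real"
    by (intro integrable_measure_pmf_finite finite_set_Pi_pmf_bernoulli) simp
  have card: "real (card {i \<in> {1..N}. b i}) = (\<Sum>i=1..N. of_bool (b i))" for b
    by (simp add: of_bool_def sum.If_cases Int_def)
  have "measure_pmf.expectation (sample_clients N q) (\<lambda>P. real (card P))
      = (\<Sum>i=1..N. measure_pmf.expectation ?M (\<lambda>b. of_bool (b i)))"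
    unfolding sample_clients_def integral_map_pmf card by (rule Bochner_Integration.integral_sum) (rule int)
  also have "\<dots> = (\<Sum>i=1..N. measure_pmf.expectation (map_pmf (\<lambda>b. b i) ?M) of_bool)"
    by simp
  also have "\<dots> = (\<Sum>i=1..N. q i)"
    using assms by (intro sum.cong refl) (subst Pi_pmf_component, auto)
  finally show ?thesis .
qed

section \<open>Structure of a run: participation lists and reachable sets\<close>

lemma length_fed_greedy:
  "(S, Ps) \<in> set_pmf (fed_greedy N f w \<kappa> sel m) \<Longrightarrow> length Ps = m"
  by (induction m arbitrary: S Ps) auto

text \<open>The sampling probabilities do not depend on the current set, so each round draws from
  the same distribution, and later rounds only append to the list.\<close>

lemma fed_greedy_participants:
  "t < m \<Longrightarrow> map_pmf (\<lambda>(S, Ps). Ps ! t) (fed_greedy N f w \<kappa> sel m)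
     = sample_clients N (client_prob w \<kappa>)"
proof (induction m)
  case 0
  then show ?case by simp
next
  case (Suc m)
  let ?D = "sample_clients N (client_prob w \<kappa>)" and ?G = "fed_greedy N f w \<kappa> sel m"
  have "map_pmf (\<lambda>(S, Ps). Ps ! t) (fed_greedy N f w \<kappa> sel (Suc m))
      = bind_pmf ?G (\<lambda>(S, Ps). map_pmf (\<lambda>P. (Ps @ [P]) ! t) ?D)"
    by (simp add: map_bind_pmf map_pmf_comp case_prod_beta')
  \<comment> \<open>Stored lists have length \<open>m\<close>, so position \<open>t\<close> is an
    old entry if \<open>t < m\<close> and otherwise, as \<open>t < Suc m\<close>, the set just
    drawn.\<close>
  also have "\<dots> = bind_pmf ?G (\<lambda>(S, Ps). if t < m then return_pmf (Ps ! t) else ?D)"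
    using Suc.prems
    by (intro bind_pmf_cong refl) (auto simp: nth_append dest!: length_fed_greedy split: prod.splits)
  also have "\<dots> = ?D"
  proof (cases "t < m")
    case True
    have "bind_pmf ?G (\<lambda>(S, Ps). return_pmf (Ps ! t)) = map_pmf (\<lambda>(S, Ps). Ps ! t) ?G"
      by (simp add: map_pmf_def case_prod_beta')
    then show ?thesis using True Suc.IH by simp
  next
    case False
    then show ?thesis by (simp add: case_prod_beta')
  qed
  finally show ?case .
qed

lemma argmax_rule_uniform:
  assumes "finite E" "S \<subseteq> E" "card S < k" "k \<le> card E" "argmax_rule E (uniform_matroid E k) sel"
  shows "is_arg_max v (\<lambda>e. e \<in> E - S) (sel t S v)"
proof -
  have "finite S" using assms finite_subset by blast
  then have cand: "candidates E (uniform_matroid E k) S = E - S"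
    using assms by (auto simp: candidates_def uniform_matroid_def)
  moreover have "E - S \<noteq> {}"
    using assms by auto
  ultimately show ?thesis using assms(5) unfolding argmax_rule_def by metis
qed

lemma fed_greedy_uniform_support:
  assumes "finite E" "m \<le> k" "k \<le> card E" "argmax_rule E (uniform_matroid E k) sel"
    and "(S, Ps) \<in> set_pmf (fed_greedy N f w \<kappa> sel m)"
  shows "S \<subseteq> E \<and> card S = m"
  using assms(2,5)
proof (induction m arbitrary: S Ps)
  case 0
  then show ?case by simp
next
  case (Suc m)
  then obtain S' P Ps' where S': "(S', Ps') \<in> set_pmf (fed_greedy N f w \<kappa> sel m)"
    and S: "S = S' \<union> {sel m S' (aggregate f (client_prob w \<kappa>) S' P)}"
    by auto
  have IH: "S' \<subseteq> E" "card S' = m" using Suc.IH[OF _ S'] Suc.prems by auto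
  have "is_arg_max (aggregate f (client_prob w \<kappa>) S' P) (\<lambda>e. e \<in> E - S')
      (sel m S' (aggregate f (client_prob w \<kappa>) S' P))"
    using IH Suc.prems assms by (intro argmax_rule_uniform) auto
  then have "sel m S' (aggregate f (client_prob w \<kappa>) S' P) \<in> E - S'"
    by (simp add: is_arg_max_def)
  then show ?case using IH S finite_subset[OF IH(1) assms(1)] by auto
qed

section \<open>The facility location objective, its marginal gains and its optimum\<close>

locale facility_location =
  fixes N :: nat and E :: "'e set" and c :: "nat \<Rightarrow> 'e \<Rightarrow> real"
  assumes finite_E: "finite E"
    and nonneg: "i \<in> {1..N} \<Longrightarrow> j \<in> E \<Longrightarrow> 0 \<le> c i j"
begin

definition gain :: "nat \<Rightarrow> 'e set \<Rightarrow> 'e \<Rightarrow> real" where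
  "gain i S e = fl_client c i (S \<union> {e}) - fl_client c i S"

definition total_gain :: "'e set \<Rightarrow> 'e \<Rightarrow> real" where
  "total_gain S e = fl_total N c (S \<union> {e}) - fl_total N c S"

lemma total_gain_eq: "total_gain S e = (\<Sum>i=1..N. gain i S e)"
  by (simp add: total_gain_def gain_def fl_total_def sum_subtractf)

lemma fl_client_ge: "S \<subseteq> E \<Longrightarrow> j \<in> S \<Longrightarrow> c i j \<le> fl_client c i S"
  using finite_subset[OF _ finite_E] by (auto simp: fl_client_def intro!: Max_ge)

lemma fl_client_attained:
  assumes "S \<subseteq> E" "S \<noteq> {}"
  shows "\<exists>j\<in>S. fl_client c i S = c i j"
proof -
  have "Max (c i ` S) \<in> c i ` S"
    using assms finite_subset[OF _ finite_E] by (intro Max_in) auto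
  then show ?thesis using assms(2) by (auto simp: fl_client_def)
qed

lemma fl_client_nonneg:
  assumes "i \<in> {1..N}" "S \<subseteq> E"
  shows "0 \<le> fl_client c i S"
proof (cases "S = {}")
  case False
  then show ?thesis using fl_client_attained[OF assms(2)] nonneg[OF assms(1)] assms(2)
    by (metis subsetD)
qed (simp add: fl_client_def)

lemma fl_client_mono:
  assumes "i \<in> {1..N}" "S \<subseteq> T" "T \<subseteq> E"
  shows "fl_client c i S \<le> fl_client c i T"
proof (cases "S = {}")
  case True
  then show ?thesis using fl_client_nonneg[OF assms(1,3)] by (simp add: fl_client_def)
next
  case False
  then obtain j where "j \<in> S" "fl_client c i S = c i j"
    using fl_client_attained[of S i] assms by auto
  then show ?thesis using fl_client_ge[of T j i] assms by auto
qed

lemma fl_total_nonneg: "S \<subseteq> E \<Longrightarrow> 0 \<le> fl_total N c S"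
  by (auto simp: fl_total_def intro!: sum_nonneg fl_client_nonneg)

lemma gain_nonneg: "i \<in> {1..N} \<Longrightarrow> S \<subseteq> E \<Longrightarrow> e \<in> E \<Longrightarrow> 0 \<le> gain i S e"
  using fl_client_mono[of i S "S \<union> {e}"] by (auto simp: gain_def)

text \<open>Diminishing returns relative to the empty set: the new maximum is attained either at
  \<open>e\<close>, or inside \<open>S\<close>, where nothing is gained.\<close>

lemma gain_le:
  assumes "i \<in> {1..N}" "S \<subseteq> E" "e \<in> E"
  shows "gain i S e \<le> c i e"
proof -
  obtain j where j: "j \<in> S \<union> {e}" "fl_client c i (S \<union> {e}) = c i j"
    using fl_client_attained[of "S \<union> {e}" i] assms by auto
  show ?thesis
    using j fl_client_ge[of S j i] fl_client_nonneg[OF assms(1,2)] nonneg[OF assms(1,3)] assms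
    by (auto simp: gain_def)
qed

lemma fl_total_singleton: "fl_total N c {j} = (\<Sum>i=1..N. c i j)"
  by (simp add: fl_total_def fl_client_def)

lemma total_gain_le: "S \<subseteq> E \<Longrightarrow> e \<in> E \<Longrightarrow> total_gain S e \<le> fl_total N c {e}"
  unfolding total_gain_eq fl_total_singleton by (intro sum_mono gain_le)

text \<open>The consequence of monotone submodularity that greedy needs, obtained client by client:
  a maximizer of the client over \<open>T\<close> either lies in \<open>S\<close>, so the difference
  is nonpositive, or its gain alone covers the difference.\<close>

lemma fl_total_diff_le_sum_gain:
  assumes "T \<subseteq> E" "S \<subseteq> E"
  shows "fl_total N c T - fl_total N c S \<le> (\<Sum>e\<in>T - S. total_gain S e)"
proof -
  have "fl_client c i T - fl_client c i S \<le> (\<Sum>e\<in>T - S. gain i S e)" if i: "i \<in> {1..N}" for i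
  proof (cases "T = {}")
    case True
    then show ?thesis using fl_client_nonneg[OF i assms(2)] by (simp add: fl_client_def)
  next
    case False
    then obtain j where j: "j \<in> T" "fl_client c i T = c i j"
      using fl_client_attained[of T i] assms by auto
    have pos: "0 \<le> gain i S e" if "e \<in> T - S" for e
      using gain_nonneg[OF i assms(2)] that assms by auto
    show ?thesis
    proof (cases "j \<in> S")
      case True
      then have "fl_client c i T - fl_client c i S \<le> 0" using fl_client_ge[OF assms(2)] j by simp
      also have "0 \<le> (\<Sum>e\<in>T - S. gain i S e)" by (intro sum_nonneg pos)
      finally show ?thesis .
    next
      case False
      have "fl_client c i T - fl_client c i S \<le> gain i S j"
        using fl_client_ge[of "S \<union> {j}" j i] j assms by (auto simp: gain_def)
      also have "\<dots> \<le> (\<Sum>e\<in>T - S. gain i S e)"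
        using j False finite_subset[OF assms(1) finite_E] pos by (intro member_le_sum) auto
      finally show ?thesis .
    qed
  qed
  then have "(\<Sum>i=1..N. fl_client c i T - fl_client c i S) \<le> (\<Sum>i=1..N. \<Sum>e\<in>T - S. gain i S e)"
    by (intro sum_mono)
  then show ?thesis
    unfolding total_gain_eq by (subst sum.swap) (simp add: fl_total_def sum_subtractf)
qed

lemma finite_feasible: "finite {S. S \<subseteq> E \<and> card S \<le> k}"
  by (rule finite_subset[of _ "Pow E"]) (auto simp: finite_E)

lemma fl_opt_ge: "S \<subseteq> E \<Longrightarrow> card S \<le> k \<Longrightarrow> fl_total N c S \<le> fl_opt N E c k"
  unfolding fl_opt_def using finite_feasible by (intro Max_ge) auto

lemma fl_opt_attained:
  obtains T where "T \<subseteq> E" "card T \<le> k" "fl_total N c T = fl_opt N E c k"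
proof -
  have "{S. S \<subseteq> E \<and> card S \<le> k} \<noteq> {}" by (auto intro: exI[of _ "{}"])
  then have "fl_opt N E c k \<in> fl_total N c ` {S. S \<subseteq> E \<and> card S \<le> k}"
    unfolding fl_opt_def using finite_feasible by (intro Max_in) auto
  then show ?thesis using that by auto
qed

lemma fl_opt_nonneg: "0 \<le> fl_opt N E c k"
  using fl_opt_ge[of "{}" k] by (simp add: fl_total_def fl_client_def)

section \<open>Importance factors\<close>

lemma score_le_importance:
  assumes "i \<in> {1..N}" "j \<in> E"
  shows "c i j \<le> fl_importance N E c i * fl_total N c {j}"
proof (cases "fl_total N c {j} = 0")
  \<comment> \<open>Here the right-hand side is 0, and so is \<open>c i j\<close>, being a summand
    of a vanishing sum of nonnegative scores.\<close>
  case True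
  have "c i j \<le> (\<Sum>i=1..N. c i j)"
    using assms nonneg by (intro member_le_sum) auto
  then show ?thesis using True by (simp add: fl_total_singleton)
next
  case False
  then have pos: "0 < fl_total N c {j}" using fl_total_nonneg[of "{j}"] assms by auto
  have "c i j / fl_total N c {j} \<le> fl_importance N E c i"
    unfolding fl_importance_def using assms finite_E by (intro Max_ge) auto
  then show ?thesis using pos by (simp add: field_simps)
qed

lemma importance_nonneg:
  assumes "i \<in> {1..N}" "E \<noteq> {}"
  shows "0 \<le> fl_importance N E c i"
proof -
  obtain j where j: "j \<in> E" using assms by blast
  have "0 \<le> c i j / fl_total N c {j}"
    using j nonneg[OF assms(1)] fl_total_nonneg[of "{j}"] by auto
  also have "\<dots> \<le> fl_importance N E c i"
    unfolding fl_importance_def using j finite_E by (intro Max_ge) auto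
  finally show ?thesis .
qed

text \<open>Bounding the maximum over facilities by the sum and exchanging sums, each facility
  accounts for at most 1.\<close>

lemma sum_importance_le:
  assumes "E \<noteq> {}"
  shows "(\<Sum>i=1..N. fl_importance N E c i) \<le> real (card E)"
proof -
  have "fl_importance N E c i \<le> (\<Sum>j\<in>E. c i j / fl_total N c {j})" if i: "i \<in> {1..N}" for i
  proof -
    have "fl_importance N E c i \<in> (\<lambda>j. c i j / fl_total N c {j}) ` E"
      unfolding fl_importance_def using finite_E assms by (intro Max_in) auto
    then obtain j where j: "j \<in> E" "fl_importance N E c i = c i j / fl_total N c {j}" by auto
    show ?thesis unfolding j(2)
      using j(1) finite_E nonneg[OF i] fl_total_nonneg by (intro member_le_sum) auto
  qed
  then have "(\<Sum>i=1..N. fl_importance N E c i) \<le> (\<Sum>i=1..N. \<Sum>j\<in>E. c i j / fl_total N c {j})"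
    by (intro sum_mono)
  also have "\<dots> = (\<Sum>j\<in>E. fl_total N c {j} / fl_total N c {j})"
    by (subst sum.swap) (simp only: fl_total_singleton sum_divide_distrib)
  \<comment> \<open>Each quotient is 1, or 0 when \<open>fl_total N c {j} = 0\<close>, by the
    convention for division by zero.\<close>
  also have "\<dots> \<le> (\<Sum>j\<in>E. 1)" by (intro sum_mono) auto
  finally show ?thesis by simp
qed

text \<open>The classical contraction of the gap, for a choice that is optimal up to \<delta>: the
  gap is at most the sum of the gains of an optimal set's at most \<open>k\<close> missing
  elements.\<close>

lemma approx_greedy_step:
  assumes S: "S \<subseteq> E" "card S < k" and e: "e \<in> E"
    and best: "\<And>j. j \<in> E - S \<Longrightarrow> total_gain S j \<le> total_gain S e + \<delta>" and "0 \<le> \<delta>"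
  shows "fl_opt N E c k - fl_total N c (S \<union> {e})
    \<le> (1 - 1 / real k) * (fl_opt N E c k - fl_total N c S) + \<delta>"
proof -
  obtain T where T: "T \<subseteq> E" "card T \<le> k" "fl_total N c T = fl_opt N E c k"
    by (rule fl_opt_attained)
  \<comment> \<open>Needed to enlarge the factor \<open>card (T - S)\<close> to \<open>k\<close>
    below.\<close>
  have g: "0 \<le> total_gain S e"
    unfolding total_gain_eq using S e by (intro sum_nonneg gain_nonneg) auto
  have "fl_opt N E c k - fl_total N c S \<le> (\<Sum>j\<in>T - S. total_gain S j)"
    using fl_total_diff_le_sum_gain[OF T(1) S(1)] T by simp
  also have "\<dots> \<le> (\<Sum>j\<in>T - S. total_gain S e + \<delta>)"
    using T by (intro sum_mono best) auto
  also have "\<dots> = real (card (T - S)) * (total_gain S e + \<delta>)" by simp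
  also have "\<dots> \<le> real k * (total_gain S e + \<delta>)"
  proof (intro mult_right_mono)
    have "card (T - S) \<le> card T"
      using T finite_E by (intro card_mono) (auto intro: finite_subset)
    then show "real (card (T - S)) \<le> real k" using T by simp
  qed (use g \<open>0 \<le> \<delta>\<close> in simp)
  finally have "(fl_opt N E c k - fl_total N c S) / real k \<le> total_gain S e + \<delta>"
    using S by (simp add: field_simps)
  then show ?thesis by (simp add: total_gain_def algebra_simps diff_divide_distrib)
qed

section \<open>Expected participation and concentration of the aggregated vector\<close>

lemma client_prob_bounds:
  assumes "E \<noteq> {}" "0 \<le> \<kappa>" "i \<in> {1..N}"
  shows "0 \<le> client_prob (fl_importance N E c) \<kappa> i \<and> client_prob (fl_importance N E c) \<kappa> i \<le> 1"
  using importance_nonneg[OF assms(3,1)] assms by (simp add: client_prob_def)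

lemma expected_participants_le:
  assumes "E \<noteq> {}" "0 \<le> \<kappa>"
  shows "measure_pmf.expectation (sample_clients N (client_prob (fl_importance N E c) \<kappa>))
           (\<lambda>P. real (card P)) \<le> \<kappa> * real (card E)"
proof -
  have "measure_pmf.expectation (sample_clients N (client_prob (fl_importance N E c) \<kappa>))
           (\<lambda>P. real (card P)) = (\<Sum>i=1..N. client_prob (fl_importance N E c) \<kappa> i)"
    by (intro expectation_card_sample_clients client_prob_bounds assms)
  also have "\<dots> \<le> (\<Sum>i=1..N. \<kappa> * fl_importance N E c i)"
    by (intro sum_mono) (simp add: client_prob_def)
  also have "\<dots> \<le> \<kappa> * real (card E)"
    unfolding sum_distrib_left[symmetric] using assms
    by (intro mult_left_mono sum_importance_le)
  finally show ?thesis .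
qed

text \<open>Unbiasedness makes the error a weighted sum of centered Bernoulli variables, and the
  one-sided bound is applied to the weights \<open>a\<close> and \<open>- a\<close>.
  \<open>M\<close> will be the optimum.\<close>

lemma aggregate_tail:
  fixes \<kappa> :: real
  defines "q \<equiv> client_prob (fl_importance N E c) \<kappa>"
  assumes "E \<noteq> {}" and \<kappa>: "0 < \<kappa>" and M: "0 < M" "\<And>j. j \<in> E \<Longrightarrow> fl_total N c {j} \<le> M"
    and S: "S \<subseteq> E" and e: "e \<in> E" and d: "0 \<le> d" "d \<le> 2 * M"
  shows "measure_pmf.prob (sample_clients N q)
           {P. d \<le> \<bar>aggregate (fl_client c) q S P e - total_gain S e\<bar>}
         \<le> 2 * exp (- (\<kappa> * d\<^sup>2 / (4 * M\<^sup>2)))"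
proof -
  define a where "a i = gain i S e / q i" for i
  define R where "R = M / \<kappa>"
  define V where "V = M\<^sup>2 / \<kappa>"
  have R: "0 < R" using M \<kappa> by (simp add: R_def)
  have V: "0 < V" "V = M * R" using M \<kappa> by (auto simp: V_def R_def power2_eq_square)
  have q: "0 \<le> q i \<and> q i \<le> 1" if "i \<in> {1..N}" for i
    using client_prob_bounds[OF \<open>E \<noteq> {}\<close> less_imp_le[OF \<kappa>] that] by (simp add: q_def)
  have g: "0 \<le> gain i S e" if "i \<in> {1..N}" for i
    using gain_nonneg[OF that S e] .
  \<comment> \<open>Below 1 the minimum in \<open>client_prob\<close> is \<kappa> times the
    importance, so importance controls the gain.\<close>
  have gR: "gain i S e \<le> q i * R" if i: "i \<in> {1..N}" "q i < 1" for i
  proof -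
    have "gain i S e \<le> c i e" by (rule gain_le[OF i(1) S e])
    also have "\<dots> \<le> fl_importance N E c i * fl_total N c {e}"
      by (rule score_le_importance[OF i(1) e])
    also have "\<dots> \<le> fl_importance N E c i * M"
      using M(2)[OF e] importance_nonneg[OF i(1) \<open>E \<noteq> {}\<close>] by (rule mult_left_mono)
    also have "\<dots> = q i * R"
      using i(2) \<kappa> by (simp add: q_def client_prob_def R_def)
    finally show ?thesis .
  qed
  \<comment> \<open>Unbiasedness. If \<open>q i = 0\<close> then \<open>a i = 0\<close> by division
    by zero, but \<open>gR\<close> forces the gain to vanish as well.\<close>
  have qa: "q i * a i = gain i S e" if i: "i \<in> {1..N}" for i
    using gR[OF i] g[OF i] by (cases "q i = 0") (auto simp: a_def)
  have a0: "0 \<le> a i" if i: "i \<in> {1..N}" for i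
    using g[OF i] q[OF i] by (simp add: a_def)
  have aR: "a i \<le> R" if i: "i \<in> {1..N}" "q i < 1" for i
    using gR[OF i] q[OF i(1)] R by (cases "q i = 0") (auto simp: a_def field_simps)
  \<comment> \<open>Only one of the two factors \<open>a i\<close> is bounded by \<open>R\<close>;
    the other turns \<open>q i\<close> into the gain, and the gains sum to at most
    \<open>M\<close>.\<close>
  have var: "(\<Sum>i | i \<in> {1..N} \<and> q i < 1. q i * (a i)\<^sup>2) \<le> V"
  proof -
    have "(\<Sum>i | i \<in> {1..N} \<and> q i < 1. q i * (a i)\<^sup>2) \<le> (\<Sum>i | i \<in> {1..N} \<and> q i < 1. gain i S e * R)"
    proof (intro sum_mono)
      fix i assume "i \<in> {i. i \<in> {1..N} \<and> q i < 1}"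
      then have i: "i \<in> {1..N}" "q i < 1" by auto
      have "q i * (a i)\<^sup>2 = gain i S e * a i"
        using qa[OF i(1)] by (simp add: power2_eq_square flip: mult.assoc)
      also have "\<dots> \<le> gain i S e * R" using aR[OF i] g[OF i(1)] by (rule mult_left_mono)
      finally show "q i * (a i)\<^sup>2 \<le> gain i S e * R" .
    qed
    also have "\<dots> \<le> (\<Sum>i=1..N. gain i S e * R)"
      using g R by (intro sum_mono2) auto
    also have "\<dots> = total_gain S e * R" by (simp add: total_gain_eq sum_distrib_right)
    also have "\<dots> \<le> M * R"
      using total_gain_le[OF S e] M(2)[OF e] R by (intro mult_right_mono) auto
    finally show ?thesis using V by simp
  qed
  \<comment> \<open>This is \<open>d \<le> 2 * M\<close> multiplied by \<open>R\<close>, as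
    \<open>V = M * R\<close>.\<close>
  have d2: "R * d \<le> 2 * V"
    using d R V by (simp add: mult.commute mult_left_mono)
  let ?D = "Pi_pmf {1..N} False (\<lambda>i. bernoulli_pmf (q i))"
  let ?X = "\<lambda>b. \<Sum>i=1..N. (of_bool (b i) - q i) * a i"
  let ?Y = "\<lambda>b. \<Sum>i=1..N. (of_bool (b i) - q i) * - a i"
  have X: "aggregate (fl_client c) q S {i \<in> {1..N}. b i} e - total_gain S e = ?X b" for b
  proof -
    have "aggregate (fl_client c) q S {i \<in> {1..N}. b i} e = (\<Sum>i=1..N. of_bool (b i) * a i)"
      unfolding aggregate_def
      by (subst sum.inter_filter) (auto simp: a_def gain_def intro!: sum.cong)
    moreover have "total_gain S e = (\<Sum>i=1..N. q i * a i)"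
      unfolding total_gain_eq by (intro sum.cong refl) (simp add: qa)
    ultimately show ?thesis by (simp add: sum_subtractf left_diff_distrib)
  qed
  have Y: "?Y b = - ?X b" for b by (simp add: sum_negf)
  have up: "measure_pmf.prob ?D {b. d \<le> ?X b} \<le> exp (- (d\<^sup>2 / (4 * V)))"
    using q aR a0 by (intro bernoulli_sum_upper_tail[OF _ _ _ var V(1) d(1) d2]) (auto simp: abs_of_nonneg)
  have lo: "measure_pmf.prob ?D {b. d \<le> ?Y b} \<le> exp (- (d\<^sup>2 / (4 * V)))"
    using q aR a0 var by (intro bernoulli_sum_upper_tail[OF _ _ _ _ V(1) d(1) d2]) (auto simp: abs_of_nonneg)
  have "measure_pmf.prob (sample_clients N q)
           {P. d \<le> \<bar>aggregate (fl_client c) q S P e - total_gain S e\<bar>}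
      = measure_pmf.prob ?D {b. d \<le> \<bar>?X b\<bar>}"
    unfolding sample_clients_def measure_map_pmf vimage_def mem_Collect_eq X ..
  also have "\<dots> \<le> measure_pmf.prob ?D ({b. d \<le> ?X b} \<union> {b. d \<le> ?Y b})"
    unfolding Y by (intro measure_pmf.finite_measure_mono) auto
  also have "\<dots> \<le> measure_pmf.prob ?D {b. d \<le> ?X b} + measure_pmf.prob ?D {b. d \<le> ?Y b}"
    by (intro measure_Un_le) auto
  also have "\<dots> \<le> 2 * exp (- (d\<^sup>2 / (4 * V)))" using up lo by simp
  finally show ?thesis by (simp add: V_def mult.commute)
qed

text \<open>Union bound over the facilities for a fixed \<open>S\<close>. The set reached by the
  algorithm is random, but each round's sample is drawn independently of it.\<close>

lemma aggregate_uniform_tail: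
  fixes \<kappa> :: real
  defines "q \<equiv> client_prob (fl_importance N E c) \<kappa>"
  assumes "E \<noteq> {}" "0 < \<kappa>" "0 < M" "\<And>j. j \<in> E \<Longrightarrow> fl_total N c {j} \<le> M"
    and "S \<subseteq> E" "0 \<le> d" "d \<le> 2 * M"
  shows "measure_pmf.prob (sample_clients N q)
           {P. \<exists>e\<in>E. d \<le> \<bar>aggregate (fl_client c) q S P e - total_gain S e\<bar>}
         \<le> real (card E) * (2 * exp (- (\<kappa> * d\<^sup>2 / (4 * M\<^sup>2))))"
proof -
  let ?A = "\<lambda>e. {P. d \<le> \<bar>aggregate (fl_client c) q S P e - total_gain S e\<bar>}"
  have "measure_pmf.prob (sample_clients N q) {P. \<exists>e\<in>E. d \<le> \<bar>aggregate (fl_client c) q S P e - total_gain S e\<bar>}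
      = measure_pmf.prob (sample_clients N q) (\<Union>e\<in>E. ?A e)"
    by (intro arg_cong[of _ _ "measure_pmf.prob (sample_clients N q)"]) auto
  also have "\<dots> \<le> (\<Sum>e\<in>E. measure_pmf.prob (sample_clients N q) (?A e))"
    using finite_E by (intro measure_pmf.finite_measure_subadditive_finite) auto
  also have "\<dots> \<le> (\<Sum>e\<in>E. 2 * exp (- (\<kappa> * d\<^sup>2 / (4 * M\<^sup>2))))"
    unfolding q_def using assms by (intro sum_mono aggregate_tail) auto
  finally show ?thesis by simp
qed

section \<open>Error accumulation over the rounds and the approximation guarantee\<close>

text \<open>Induction on rounds: each one contracts the gap, adds \<open>2 * d\<close> to the
  additive error, and adds one uniform tail bound to the failure probability.\<close>

lemma fed_greedy_gap:
  fixes \<kappa> :: real and k :: nat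
  defines "Alg \<equiv> fed_greedy N (fl_client c) (fl_importance N E c) \<kappa>"
  defines "OPT \<equiv> fl_opt N E c k"
  assumes \<kappa>: "0 < \<kappa>" and OPT: "0 < OPT" and d: "0 \<le> d" "d \<le> 2 * OPT"
    and k: "1 \<le> k" "k \<le> card E" and sel: "argmax_rule E (uniform_matroid E k) sel" and "m \<le> k"
  shows "measure_pmf.prob (Alg sel m)
      {(S, Ps). (1 - 1 / real k) ^ m * OPT + 2 * d * real m < OPT - fl_total N c S}
    \<le> real m * (real (card E) * (2 * exp (- (\<kappa> * d\<^sup>2 / (4 * OPT\<^sup>2)))))"
  using \<open>m \<le> k\<close>
proof (induction m)
  case 0
  have "fl_total N c {} = 0" by (simp add: fl_total_def fl_client_def)
  then show ?case by (simp add: Alg_def)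
next
  case (Suc m)
  define q where "q = client_prob (fl_importance N E c) \<kappa>"
  define p where "p = real (card E) * (2 * exp (- (\<kappa> * d\<^sup>2 / (4 * OPT\<^sup>2))))"
  define bad where "bad m = {(S, Ps :: nat set list).
      (1 - 1 / real k) ^ m * OPT + 2 * d * real m < OPT - fl_total N c S}" for m
  have E: "E \<noteq> {}" using k by auto
  \<comment> \<open>Singletons are feasible because \<open>1 \<le> k\<close>, so \<open>OPT\<close>
    can serve as the bound \<open>M\<close> of the tail lemmas.\<close>
  have F: "fl_total N c {j} \<le> OPT" if "j \<in> E" for j
    unfolding OPT_def using that k by (intro fl_opt_ge) auto
  have "measure_pmf.prob (Alg sel (Suc m)) (bad (Suc m)) \<le> measure_pmf.prob (Alg sel m) (bad m) + p"
    unfolding Alg_def fed_greedy.simps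
  proof (rule measure_bind_pmf_le)
    show "0 \<le> p" by (simp add: p_def)
    fix x assume x: "x \<in> set_pmf (fed_greedy N (fl_client c) (fl_importance N E c) \<kappa> sel m)" "x \<notin> bad m"
    obtain S Ps where SPs: "x = (S, Ps)" by (cases x)
    have S: "S \<subseteq> E" "card S = m"
      using fed_greedy_uniform_support[OF finite_E _ k(2) sel, of m S Ps] x(1) Suc.prems
      unfolding SPs by auto
    have gap: "OPT - fl_total N c S \<le> (1 - 1 / real k) ^ m * OPT + 2 * d * real m"
      using x(2) by (simp add: SPs bad_def)
    have good: "(S \<union> {sel m S (aggregate (fl_client c) q S P)}, Ps') \<notin> bad (Suc m)"
      if P: "\<And>e. e \<in> E \<Longrightarrow> \<bar>aggregate (fl_client c) q S P e - total_gain S e\<bar> < d" for P Ps'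
    proof -
      let ?v = "aggregate (fl_client c) q S P"
      let ?e = "sel m S ?v"
      have "is_arg_max ?v (\<lambda>e. e \<in> E - S) ?e"
        using S Suc.prems k sel by (intro argmax_rule_uniform finite_E) auto
      then have e: "?e \<in> E" "\<And>j. j \<in> E - S \<Longrightarrow> ?v j \<le> ?v ?e"
        by (auto simp: is_arg_max_def not_less)
      \<comment> \<open>The loss is \<open>2 * d\<close>: the chosen facility may be overestimated
        and its competitor underestimated, each by less than \<open>d\<close>.\<close>
      have "OPT - fl_total N c (S \<union> {?e}) \<le> (1 - 1 / real k) * (OPT - fl_total N c S) + 2 * d"
        unfolding OPT_def
      proof (intro approx_greedy_step)
        fix j assume j: "j \<in> E - S"
        show "total_gain S j \<le> total_gain S ?e + 2 * d"
          using e(2)[OF j] P[OF e(1)] P[of j] j by (simp add: abs_less_iff)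
      qed (use S Suc.prems e d in auto)
      also have "\<dots> \<le> (1 - 1 / real k) * ((1 - 1 / real k) ^ m * OPT + 2 * d * real m) + 2 * d"
        using gap k by (intro add_right_mono mult_left_mono) auto
      \<comment> \<open>The contraction of the earlier errors is given away.\<close>
      also have "\<dots> \<le> (1 - 1 / real k) ^ Suc m * OPT + 2 * d * real (Suc m)"
        using d by (simp add: algebra_simps)
      finally show ?thesis by (simp add: bad_def)
    qed
    have "measure_pmf.prob (map_pmf (\<lambda>P. (S \<union> {sel m S (aggregate (fl_client c) q S P)}, Ps @ [P]))
          (sample_clients N q)) (bad (Suc m))
        \<le> measure_pmf.prob (sample_clients N q)
           {P. \<exists>e\<in>E. d \<le> \<bar>aggregate (fl_client c) q S P e - total_gain S e\<bar>}"
      unfolding measure_map_pmf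
    proof (intro measure_pmf.finite_measure_mono subsetI)
      fix P assume "P \<in> (\<lambda>P. (S \<union> {sel m S (aggregate (fl_client c) q S P)}, Ps @ [P])) -` bad (Suc m)"
      then show "P \<in> {P. \<exists>e\<in>E. d \<le> \<bar>aggregate (fl_client c) q S P e - total_gain S e\<bar>}"
        using good[of P "Ps @ [P]"] by (auto simp: not_less[symmetric])
    qed auto
    also have "\<dots> \<le> p"
      unfolding q_def p_def using E \<kappa> OPT F S d by (intro aggregate_uniform_tail) auto
    finally show "measure_pmf.prob (case x of (S, Ps) \<Rightarrow>
        map_pmf (\<lambda>P. (S \<union> {sel m S (aggregate (fl_client c) (client_prob (fl_importance N E c) \<kappa>) S P)}, Ps @ [P]))
          (sample_clients N (client_prob (fl_importance N E c) \<kappa>))) (bad (Suc m)) \<le> p"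
      by (simp add: SPs q_def)
  qed
  also have "measure_pmf.prob (Alg sel m) (bad m) \<le> real m * p"
    using Suc.IH Suc.prems by (simp add: p_def bad_def)
  finally show ?case by (simp add: p_def[symmetric] bad_def algebra_simps)
qed

lemma fed_greedy_approximation:
  assumes \<epsilon>: "0 < \<epsilon>" "\<epsilon> < 1" and k: "1 \<le> k" "k \<le> card E"
    and sel: "argmax_rule E (uniform_matroid E k) sel"
    and \<kappa>: "16 * (real k)\<^sup>2 * ln (2 * real (card E) ^ 3) / \<epsilon>\<^sup>2 \<le> \<kappa>" "0 < \<kappa>"
  shows "1 - 1 / real (card E) \<le> measure_pmf.prob
      (fed_greedy N (fl_client c) (fl_importance N E c) \<kappa> sel k)
      {(S, Ps). (1 - 1 / exp 1 - \<epsilon>) * fl_opt N E c k \<le> fl_total N c S}"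
    (is "_ \<le> measure_pmf.prob ?Alg ?good")
proof (cases "fl_opt N E c k = 0")
  \<comment> \<open>With optimum 0 any nonnegative value suffices; the tail bounds require a
    positive one.\<close>
  case True
  have "0 \<le> fl_total N c S" if "(S, Ps) \<in> set_pmf ?Alg" for S Ps
    using fed_greedy_uniform_support[OF finite_E order_refl k(2) sel that] by (simp add: fl_total_nonneg)
  then have "set_pmf ?Alg \<subseteq> ?good"
    using True by auto
  then have "measure_pmf.prob ?Alg ?good = 1"
    by (subst measure_pmf.prob_eq_1) (auto simp: AE_measure_pmf_iff)
  then show ?thesis by simp
next
  case False
  define OPT where "OPT = fl_opt N E c k"
  define n where "n = real (card E)"
  have OPT: "0 < OPT" using False fl_opt_nonneg[of k] by (simp add: OPT_def)
  have n: "real k \<le> n" "1 \<le> n" using k by (auto simp: n_def)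
  \<comment> \<open>Chosen so that \<open>k\<close> rounds with loss \<open>2 * d\<close> cost
    \<open>\<epsilon> * OPT\<close> in total.\<close>
  define d where "d = \<epsilon> * OPT / (2 * real k)"
  have "\<epsilon> * OPT \<le> 4 * real k * OPT"
    using \<epsilon> k OPT by (intro mult_right_mono) auto
  then have d: "0 \<le> d" "d \<le> 2 * OPT"
    using \<epsilon> OPT k by (auto simp: d_def field_simps)
  have dk: "2 * d * real k = \<epsilon> * OPT" using k by (simp add: d_def)
  let ?bad = "{(S, Ps :: nat set list). (1 - 1 / real k) ^ k * OPT + 2 * d * real k < OPT - fl_total N c S}"
  have "ln (2 * n ^ 3) \<le> \<kappa> * \<epsilon>\<^sup>2 / (16 * (real k)\<^sup>2)"
    using \<kappa>(1) \<epsilon> k by (simp add: field_simps n_def)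
  \<comment> \<open>The constant 16 is the 4 of the tail exponent times the square of the 2 in
    \<open>d\<close>.\<close>
  also have "\<dots> = \<kappa> * d\<^sup>2 / (4 * OPT\<^sup>2)"
    using OPT k by (simp add: d_def power2_eq_square field_simps)
  finally have "exp (- (\<kappa> * d\<^sup>2 / (4 * OPT\<^sup>2))) \<le> exp (- ln (2 * n ^ 3))" by simp
  also have "\<dots> = 1 / (2 * n ^ 3)"
    using n by (simp add: exp_minus field_simps)
  finally have e: "exp (- (\<kappa> * d\<^sup>2 / (4 * OPT\<^sup>2))) \<le> 1 / (2 * n ^ 3)" .
  have "measure_pmf.prob ?Alg ?bad \<le> real k * (n * (2 * exp (- (\<kappa> * d\<^sup>2 / (4 * OPT\<^sup>2)))))"
    unfolding n_def OPT_def
    by (rule fed_greedy_gap) (use \<kappa> OPT d k sel in \<open>auto simp: OPT_def\<close>)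
  \<comment> \<open>The factors count rounds (\<open>k \<le> n\<close>), facilities and the two
    tails.\<close>
  also have "\<dots> \<le> n * (n * (2 * (1 / (2 * n ^ 3))))"
    using e n by (intro mult_mono) auto
  also have "\<dots> = 1 / n"
    using n by (simp add: field_simps power3_eq_cube)
  finally have "1 - 1 / n \<le> 1 - measure_pmf.prob ?Alg ?bad" by simp
  also have "\<dots> = measure_pmf.prob ?Alg (- ?bad)"
    using measure_pmf.prob_compl[of ?bad ?Alg] by (simp add: Compl_eq_Diff_UNIV)
  also have "\<dots> \<le> measure_pmf.prob ?Alg ?good"
  proof (intro measure_pmf.finite_measure_mono)
    have "(1 - 1 / real k) ^ k \<le> 1 / exp 1"
      using exp_ge_one_minus_x_over_n_power_n[of 1 k] k by (simp add: exp_minus field_simps)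
    then have "(1 - 1 / real k) ^ k * OPT \<le> 1 / exp 1 * OPT"
      using OPT by (intro mult_right_mono) auto
    then show "- ?bad \<subseteq> ?good"
      unfolding dk OPT_def[symmetric] by (auto simp: algebra_simps)
  qed auto
  finally show ?thesis by (simp add: n_def)
qed

end

section \<open>Soft-O bounds and choice of the parameters\<close>

text \<open>As \<open>n\<close> is at most \<open>g\<close>, \<open>2 * n ^ 3\<close> is at most the
  fourth power of \<open>2 + g\<close>, so one logarithm of \<open>2 + g\<close> suffices, with
  constant \<open>4 * \<bar>C\<bar>\<close>.\<close>

lemma soft_bigo_log_factor:
  assumes "\<And>k n \<epsilon>. (k, n, \<epsilon>) \<in> fl_params \<Longrightarrow> real n \<le> g (k, n, \<epsilon>)"
  shows "(\<lambda>(k, n, \<epsilon>). C * (g (k, n, \<epsilon>) * ln (2 * real n ^ 3))) \<in> soft_bigo fl_params g"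
proof -
  have "\<bar>C * (g (k, n, \<epsilon>) * ln (2 * real n ^ 3))\<bar>
      \<le> (4 * \<bar>C\<bar>) * (g (k, n, \<epsilon>) * ln (2 + g (k, n, \<epsilon>)) ^ 1)"
    if "(k, n, \<epsilon>) \<in> fl_params" for k n \<epsilon>
  proof -
    let ?g = "g (k, n, \<epsilon>)"
    have n: "1 \<le> real n" "real n \<le> ?g" using that assms by (auto simp: fl_params_def)
    have "2 * real n ^ 3 \<le> (2 + real n) * (2 + real n) ^ 3"
      by (intro mult_mono power_mono) auto
    also have "\<dots> = (2 + real n) ^ 4" by (simp add: power_numeral_reduce)
    also have "\<dots> \<le> (2 + ?g) ^ 4" using n by (intro power_mono) auto
    finally have "ln (2 * real n ^ 3) \<le> ln ((2 + ?g) ^ 4)" using n by (subst ln_le_cancel_iff) auto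
    also have "\<dots> = 4 * ln (2 + ?g)" using n by (simp add: ln_realpow)
    finally have le: "ln (2 * real n ^ 3) \<le> 4 * ln (2 + ?g)" .
    have "1 \<le> real n ^ 3" using n by simp
    then have "0 \<le> ln (2 * real n ^ 3)" by (intro ln_ge_zero) simp
    then have "\<bar>C * (?g * ln (2 * real n ^ 3))\<bar> = \<bar>C\<bar> * (?g * ln (2 * real n ^ 3))"
      using n by (simp add: abs_mult)
    also have "\<dots> \<le> \<bar>C\<bar> * (?g * (4 * ln (2 + ?g)))"
      using le n by (intro mult_left_mono) auto
    finally show ?thesis by simp
  qed
  then show ?thesis
    unfolding soft_bigo_def by (intro CollectI exI[of _ "4 * \<bar>C\<bar>"] exI[of _ 1]) auto
qed

theorem theoremD2:
  "\<exists>\<kappa> B.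
     \<kappa> \<in> soft_bigo fl_params (\<lambda>(k, n, \<epsilon>). real k * real n / \<epsilon>\<^sup>2) \<and>
     B \<in> soft_bigo fl_params (\<lambda>(k, n, \<epsilon>). real k * (real n)\<^sup>2 / \<epsilon>\<^sup>2) \<and>
     (\<forall>(N::nat) (E::'e set) (n::nat) (k::nat) (\<epsilon>::real) (c::nat \<Rightarrow> 'e \<Rightarrow> real) sel.
        finite E \<and> card E = n \<and> 1 \<le> k \<and> k \<le> n \<and> 0 < \<epsilon> \<and> \<epsilon> < 1 \<and>
        (\<forall>i\<in>{1..N}. \<forall>j\<in>E. 0 \<le> c i j) \<and>
        argmax_rule E (uniform_matroid E k) sel \<longrightarrow>
        (let Alg = fed_greedy N (fl_client c) (fl_importance N E c) (\<kappa> (k, n, \<epsilon>)) sel k in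
           0 < \<kappa> (k, n, \<epsilon>) \<and>
           (\<forall>(S, Ps)\<in>set_pmf Alg. S \<subseteq> E \<and> card S = k \<and> length Ps = k) \<and>
           measure_pmf.prob Alg
             {(S, Ps). (1 - 1 / exp 1 - \<epsilon>) * fl_opt N E c k \<le> fl_total N c S} \<ge> 1 - 1 / real n \<and>
           (\<forall>t<k. measure_pmf.expectation Alg (\<lambda>(S, Ps). real (card (Ps ! t))) \<le> B (k, n, \<epsilon>))))"
proof -
  define g1 g2 :: "nat \<times> nat \<times> real \<Rightarrow> real"
    where "g1 = (\<lambda>(k, n, \<epsilon>). real k * real n / \<epsilon>\<^sup>2)"
      and "g2 = (\<lambda>(k, n, \<epsilon>). real k * (real n)\<^sup>2 / \<epsilon>\<^sup>2)"
  define \<kappa> where "\<kappa> = (\<lambda>(k, n, \<epsilon>). 16 * (g1 (k, n, \<epsilon>) * ln (2 * real n ^ 3)))"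
  \<comment> \<open>This is \<kappa> times \<open>n\<close>, the bound of
    \<open>expected_participants_le\<close>.\<close>
  define B where "B = (\<lambda>(k, n, \<epsilon>). 16 * (g2 (k, n, \<epsilon>) * ln (2 * real n ^ 3)))"
  have g1: "real n \<le> g1 (k, n, \<epsilon>)" if "(k, n, \<epsilon>) \<in> fl_params" for k n \<epsilon>
  proof -
    have "\<epsilon>\<^sup>2 \<le> 1" "1 \<le> real k" "0 < \<epsilon>" using that by (auto simp: fl_params_def power_le_one)
    then have "real n * \<epsilon>\<^sup>2 \<le> real n * real k" by (intro mult_left_mono) auto
    then show ?thesis using \<open>0 < \<epsilon>\<close> by (simp add: g1_def field_simps)
  qed
  have g21: "g2 (k, n, \<epsilon>) = g1 (k, n, \<epsilon>) * real n" for k n \<epsilon>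
    by (simp add: g1_def g2_def power2_eq_square)
  have g2: "real n \<le> g2 (k, n, \<epsilon>)" if "(k, n, \<epsilon>) \<in> fl_params" for k n \<epsilon>
  proof -
    have n: "1 \<le> real n" using that by (auto simp: fl_params_def)
    have "g1 (k, n, \<epsilon>) * 1 \<le> g1 (k, n, \<epsilon>) * real n"
      using n g1[OF that] by (intro mult_left_mono) auto
    then show ?thesis using g1[OF that] g21 by simp
  qed
  have \<kappa>_bigo: "\<kappa> \<in> soft_bigo fl_params g1"
    unfolding \<kappa>_def by (rule soft_bigo_log_factor) (rule g1)
  have B_bigo: "B \<in> soft_bigo fl_params g2"
    unfolding B_def by (rule soft_bigo_log_factor) (rule g2)
  have main: "let Alg = fed_greedy N (fl_client c) (fl_importance N E c) (\<kappa> (k, n, \<epsilon>)) sel k in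
           0 < \<kappa> (k, n, \<epsilon>) \<and>
           (\<forall>(S, Ps)\<in>set_pmf Alg. S \<subseteq> E \<and> card S = k \<and> length Ps = k) \<and>
           measure_pmf.prob Alg
             {(S, Ps). (1 - 1 / exp 1 - \<epsilon>) * fl_opt N E c k \<le> fl_total N c S} \<ge> 1 - 1 / real n \<and>
           (\<forall>t<k. measure_pmf.expectation Alg (\<lambda>(S, Ps). real (card (Ps ! t))) \<le> B (k, n, \<epsilon>))"
    if asm: "finite E" "card E = n" "1 \<le> k" "k \<le> n" "0 < \<epsilon>" "\<epsilon> < 1"
        "\<forall>i\<in>{1..N}. \<forall>j\<in>E. 0 \<le> c i j" "argmax_rule E (uniform_matroid E k) sel"
    for N n k \<epsilon> c sel and E :: "'e set"
  proof -
    interpret facility_location N E c using asm by unfold_locales auto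
    have E: "E \<noteq> {}" using asm by auto
    have params: "(k, n, \<epsilon>) \<in> fl_params" using asm by (simp add: fl_params_def)
    have n: "1 \<le> real n" using asm by simp
    then have "1 \<le> real n ^ 3" by simp
    then have ln: "0 < ln (2 * real n ^ 3)" by (intro ln_gt_zero) simp
    have \<kappa>: "0 < \<kappa> (k, n, \<epsilon>)"
      using ln g1[OF params] n by (simp add: \<kappa>_def)
    have B: "B (k, n, \<epsilon>) = \<kappa> (k, n, \<epsilon>) * real (card E)"
      using asm by (simp add: \<kappa>_def B_def g21)
    \<comment> \<open>The analysis asks for \<kappa> of order \<open>k\<^sup>2\<close>; the chosen
      order \<open>k * n\<close> dominates it.\<close>
    have "(real k)\<^sup>2 \<le> real k * real n" using asm by (simp add: power2_eq_square)
    then have "16 * (real k)\<^sup>2 * ln (2 * real n ^ 3) / \<epsilon>\<^sup>2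
        \<le> 16 * (real k * real n) * ln (2 * real n ^ 3) / \<epsilon>\<^sup>2"
      using ln by (intro divide_right_mono mult_right_mono mult_left_mono) auto
    then have \<kappa>_ge: "16 * (real k)\<^sup>2 * ln (2 * real (card E) ^ 3) / \<epsilon>\<^sup>2 \<le> \<kappa> (k, n, \<epsilon>)"
      using asm by (simp add: \<kappa>_def g1_def)
    define Alg where "Alg = fed_greedy N (fl_client c) (fl_importance N E c) (\<kappa> (k, n, \<epsilon>)) sel k"
    have "S \<subseteq> E \<and> card S = k \<and> length Ps = k" if "(S, Ps) \<in> set_pmf Alg" for S Ps
      using fed_greedy_uniform_support[of E k k sel] length_fed_greedy asm that
      unfolding Alg_def by blast
    moreover have "1 - 1 / real n \<le> measure_pmf.prob Alg
        {(S, Ps). (1 - 1 / exp 1 - \<epsilon>) * fl_opt N E c k \<le> fl_total N c S}"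
      using fed_greedy_approximation[OF asm(5,6,3) _ asm(8) \<kappa>_ge \<kappa>] asm by (simp add: Alg_def)
    moreover have "measure_pmf.expectation Alg (\<lambda>(S, Ps). real (card (Ps ! t))) \<le> B (k, n, \<epsilon>)"
      if "t < k" for t
    proof -
      \<comment> \<open>Only the marginal of entry \<open>t\<close> matters, and that is a single
        client sample.\<close>
      have "measure_pmf.expectation Alg (\<lambda>(S, Ps). real (card (Ps ! t)))
          = measure_pmf.expectation (map_pmf (\<lambda>(S, Ps). Ps ! t) Alg) (\<lambda>P. real (card P))"
        by (simp add: case_prod_beta')
      also have "\<dots> \<le> B (k, n, \<epsilon>)"
        unfolding Alg_def fed_greedy_participants[OF that] B
        using expected_participants_le[OF E] \<kappa> by simp
      finally show ?thesis .
    qed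
    ultimately show ?thesis using \<kappa> unfolding Let_def Alg_def by blast
  qed
  show ?thesis
    by (rule exI[of _ \<kappa>], rule exI[of _ B])
       (use \<kappa>_bigo B_bigo main in \<open>simp add: g1_def g2_def\<close>)
qed

end
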